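(* Let $0<\alpha<1$, and let $f:\Pi\to\mathbb R$ be a bounded function on $\Pi=\Pi_0=\{x_1=0\}\subset\mathbb H^1$. Then $f\in C^{2,\alpha}(\Pi)$ if and only if $f\in\Gamma^{2,\alpha}(\Pi)$, namely if and only if there is $C>0$ such that for each $\hat x\in\Pi$ there is a polynomial $$P_{\hat x}(\hat y)=a_{\hat x}+b_{\hat x}v_2+c_{\hat x}v_2^2+d_{\hat x}v_3,\qquad \hat v=(v_2,v_3)=\hat y-\hat x,$$ such that for every $\rho>0$ and every $\hat y\in B_\rho(\hat x)$, $$|f(\hat y)-P_{\hat x}(\hat y)|<C\rho^{2+\alpha}.$$
   Context: Points of $\Pi=\{x_1=0\}$ are written $\hat x=(x_2,x_3)\in\mathbb R^2$. The distance on $\Pi$ is $\tilde d(\hat x,\hat y)=((x_2-y_2)^4+16(x_3-y_3)^2)^{1/4}$ and $B_\rho(\hat x)=\{\hat y\in\Pi:\tilde d(\hat x,\hat y)<\rho\}$. A function $f$ on $\Pi$ belongs to $C^{2,\alpha}(\Pi)$ if $\partial_2^2f$ and $\partial_3f$ exist and are continuous and there is $C>0$ with $|\partial_2^2f(\hat y)-\partial_2^2f(\hat x)|\le C\tilde d(\hat x,\hat y)^\alpha$ and $|\partial_3f(\hat y)-\partial_3f(\hat x)|\le C\tilde d(\hat x,\hat y)^\alpha$ for all $\hat x,\hat y\in\Pi$. *)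

theory Defs
  imports "HOL-Analysis.Analysis"
begin

text \<open>
  A point \<open>(0, x\<^sub>2, x\<^sub>3)\<close> of the plane \<open>\<Pi> = {x\<^sub>1 = 0}\<close> of the Heisenberg group is represented by
  the pair \<open>(x\<^sub>2, x\<^sub>3)\<close>, so a function on \<open>\<Pi>\<close> is a function on \<^typ>\<open>real \<times> real\<close>.
\<close>

definition dist_Pi :: "real \<times> real \<Rightarrow> real \<times> real \<Rightarrow> real" where
  "dist_Pi x y = root 4 ((fst x - fst y) ^ 4 + 16 * (snd x - snd y) ^ 2)"

definition ball_Pi :: "real \<times> real \<Rightarrow> real \<Rightarrow> (real \<times> real) set" where
  "ball_Pi x \<rho> = {y. dist_Pi x y < \<rho>}"

text \<open>The subscripts 2 and 3 name the coordinates \<open>x\<^sub>2\<close> and \<open>x\<^sub>3\<close>, i.e. \<^const>\<open>fst\<close> and \<^const>\<open>snd\<close>.\<close>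

definition has_partial2 :: "(real \<times> real \<Rightarrow> real) \<Rightarrow> (real \<times> real \<Rightarrow> real) \<Rightarrow> bool" where
  "has_partial2 f f' \<longleftrightarrow>
     (\<forall>x. ((\<lambda>t. f (t, snd x)) has_real_derivative f' x) (at (fst x)))"

definition has_partial3 :: "(real \<times> real \<Rightarrow> real) \<Rightarrow> (real \<times> real \<Rightarrow> real) \<Rightarrow> bool" where
  "has_partial3 f f' \<longleftrightarrow>
     (\<forall>x. ((\<lambda>t. f (fst x, t)) has_real_derivative f' x) (at (snd x)))"

text \<open>
  Continuity below is with respect to the Euclidean topology, which is also the topology
  induced by \<^const>\<open>dist_Pi\<close>. The witnesses \<open>f2\<close>, \<open>f22\<close>, \<open>f3\<close> are necessarily
  \<open>\<partial>\<^sub>2 f\<close>, \<open>\<partial>\<^sub>2\<^sup>2 f\<close>, \<open>\<partial>\<^sub>3 f\<close>.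
\<close>

definition C2_Pi :: "real \<Rightarrow> (real \<times> real \<Rightarrow> real) set" where
  "C2_Pi \<alpha> = {f. \<exists>f2 f22 f3.
     has_partial2 f f2 \<and> has_partial2 f2 f22 \<and> has_partial3 f f3 \<and>
     continuous_on UNIV f22 \<and> continuous_on UNIV f3 \<and>
     (\<exists>C>0. \<forall>x y.
        \<bar>f22 y - f22 x\<bar> \<le> C * dist_Pi x y powr \<alpha> \<and>
        \<bar>f3 y - f3 x\<bar> \<le> C * dist_Pi x y powr \<alpha>)}"

text \<open>The constant \<open>C\<close> is uniform in the centre \<open>x\<close>; the polynomial at \<open>x\<close> does not depend on \<open>\<rho>\<close>.\<close>

definition Gamma2_Pi :: "real \<Rightarrow> (real \<times> real \<Rightarrow> real) set" where
  "Gamma2_Pi \<alpha> = {f. \<exists>C>0. \<forall>x. \<exists>a b c d. \<forall>\<rho>>0. \<forall>y \<in> ball_Pi x \<rho>.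
     (let v2 = fst (y - x); v3 = snd (y - x) in
        \<bar>f y - (a + b * v2 + c * v2 ^ 2 + d * v3)\<bar> < C * \<rho> powr (2 + \<alpha>))}"

end

theory Submission
  imports Defs
begin

text \<open>
  The point of the statement is that the anisotropic distance weighs \<open>x\<^sub>3\<close> like the square of
  \<open>x\<^sub>2\<close>, so that \<open>a + b v\<^sub>2 + c v\<^sub>2\<^sup>2 + d v\<^sub>3\<close> is the general polynomial of degree at most two for
  the dilations \<open>(v\<^sub>2, v\<^sub>3) \<mapsto> (r v\<^sub>2, r\<^sup>2 v\<^sub>3)\<close>.

  If \<open>f\<close> has Hoelder derivatives, its polynomial at \<open>x\<close> is the Taylor polynomial: go from \<open>x\<close>
  to \<open>y\<close> first along \<open>x\<^sub>2\<close>, with the second order Taylor formula, then along \<open>x\<^sub>3\<close>, with the mean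
  value theorem. Each Lagrange remainder evaluates a top-order derivative at a point no
  farther from \<open>x\<close> than \<open>y\<close>, and so differs from its value at \<open>x\<close> by \<open>O(d(x,y)\<^sup>\<alpha>)\<close>.

  Conversely, restricting the approximation to the two coordinate lines through \<open>x\<close> shows that
  \<open>b\<^sub>x = \<partial>\<^sub>2 f(x)\<close> and \<open>d\<^sub>x = \<partial>\<^sub>3 f(x)\<close>. What remains is to control how the coefficients vary
  with the centre, and this is Campanato's argument: if \<open>r = d(x,z)\<close>, the polynomials at \<open>x\<close> and
  at \<open>z\<close> are both within \<open>O(r\<^sup>2\<^sup>+\<^sup>\<alpha>)\<close> of \<open>f\<close> on the ball of radius \<open>r\<close> about \<open>x\<close>, so their
  difference is \<open>O(r\<^sup>2\<^sup>+\<^sup>\<alpha>)\<close> there, and the coefficient of a monomial of degree \<open>k\<close> in the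
  difference is \<open>O(r\<^sup>2\<^sup>+\<^sup>\<alpha>\<^sup>-\<^sup>k)\<close> (\<open>coefficients_vary\<close>). For \<open>k = 2\<close> this is the Hoelder
  continuity of \<open>c\<close> and \<open>d\<close>; for \<open>k = 1\<close> it says that \<open>b\<close> is differentiable along \<open>x\<^sub>2\<close> with
  derivative \<open>2 c\<close>, so that \<open>\<partial>\<^sub>2\<^sup>2 f = 2 c\<close>.
\<close>

section \<open>The anisotropic distance\<close>

lemma dist_Pi_nonneg: "0 \<le> dist_Pi x y"
  unfolding dist_Pi_def by (intro real_root_ge_zero) simp

lemma dist_Pi_pow4: "dist_Pi x y ^ 4 = (fst x - fst y) ^ 4 + 16 * (snd x - snd y)\<^sup>2"
  unfolding dist_Pi_def by (intro real_root_pow_pos2) simp_all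

lemma dist_Pi_le_iff:
  assumes "0 \<le> \<rho>"
  shows "dist_Pi x y \<le> \<rho> \<longleftrightarrow> (fst x - fst y) ^ 4 + 16 * (snd x - snd y)\<^sup>2 \<le> \<rho> ^ 4"
  using power_mono_iff[of "dist_Pi x y" \<rho> 4] assms dist_Pi_nonneg[of x y]
  by (simp add: dist_Pi_pow4)

lemma dist_Pi_self [simp]: "dist_Pi x x = 0"
  by (simp add: dist_Pi_def)

lemma dist_Pi_mono:
  assumes "\<bar>fst y - fst x\<bar> \<le> \<bar>fst z - fst x\<bar>" "\<bar>snd y - snd x\<bar> \<le> \<bar>snd z - snd x\<bar>"
  shows "dist_Pi x y \<le> dist_Pi x z"
proof -
  have "(fst x - fst y) ^ 4 \<le> (fst x - fst z) ^ 4"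
    using power_mono[OF assms(1), of 4] by (simp add: power_even_abs abs_minus_commute)
  moreover have "(snd x - snd y)\<^sup>2 \<le> (snd x - snd z)\<^sup>2"
    using assms(2) by (simp add: abs_le_square_iff power2_commute)
  ultimately show ?thesis
    unfolding dist_Pi_le_iff[OF dist_Pi_nonneg] dist_Pi_pow4 by linarith
qed

lemma dist_Pi_along_fst: "dist_Pi (s, t) (s', t) = \<bar>s' - s\<bar>"
proof -
  have "dist_Pi (s, t) (s', t) ^ 4 = \<bar>s' - s\<bar> ^ 4"
    by (simp add: dist_Pi_pow4 power_even_abs abs_minus_commute)
  then show ?thesis
    using power_eq_imp_eq_base[of _ 4] dist_Pi_nonneg by fastforce
qed

lemma dist_Pi_along_snd: "dist_Pi (s, t) (s, t') = 2 * sqrt \<bar>t' - t\<bar>"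
proof -
  have "sqrt \<bar>t' - t\<bar> ^ 4 = (t - t')\<^sup>2"
    using power_mult[of "sqrt \<bar>t' - t\<bar>" 2 2] by (simp add: power2_commute)
  then have "dist_Pi (s, t) (s, t') ^ 4 = (2 * sqrt \<bar>t' - t\<bar>) ^ 4"
    by (simp add: dist_Pi_pow4 power_mult_distrib)
  then show ?thesis
    using power_eq_imp_eq_base[of _ 4 "2 * sqrt \<bar>t' - t\<bar>"] dist_Pi_nonneg by fastforce
qed

lemma abs_fst_diff_le_dist_Pi: "\<bar>fst y - fst x\<bar> \<le> dist_Pi x y"
  using dist_Pi_mono[of "(fst y, snd x)" x y] dist_Pi_along_fst[of "fst x" "snd x" "fst y"] by simp

lemma abs_snd_diff_le_dist_Pi: "4 * \<bar>snd y - snd x\<bar> \<le> (dist_Pi x y)\<^sup>2"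
proof -
  have "2 * sqrt \<bar>snd y - snd x\<bar> \<le> dist_Pi x y"
    using dist_Pi_mono[of "(fst x, snd y)" x y] dist_Pi_along_snd[of "fst x" "snd x" "snd y"] by simp
  then have "(2 * sqrt \<bar>snd y - snd x\<bar>)\<^sup>2 \<le> (dist_Pi x y)\<^sup>2"
    by (intro power_mono) auto
  then show ?thesis by (simp add: power_mult_distrib)
qed

lemma dist_Pi_eq_0_iff [simp]: "dist_Pi x y = 0 \<longleftrightarrow> x = y"
  using abs_fst_diff_le_dist_Pi[of y x] abs_snd_diff_le_dist_Pi[of y x]
  by (auto intro: prod_eqI)

text \<open>
  Convexity of the fourth power and of the square gives \<open>d(z,w)\<^sup>4 \<le> 8 (d(x,z)\<^sup>4 + d(x,w)\<^sup>4)\<close>, and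
  with \<open>16 = 2\<^sup>4\<close> the following substitute for the triangle inequality.
\<close>

lemma dist_Pi_quasi_triangle:
  assumes "dist_Pi x z \<le> r" "dist_Pi x w \<le> r"
  shows "dist_Pi z w \<le> 2 * r"
proof -
  have r: "0 \<le> r" using assms(1) dist_Pi_nonneg[of x z] by linarith
  have sq: "(u - v)\<^sup>2 \<le> 2 * (u\<^sup>2 + v\<^sup>2)" for u v :: real
    using zero_le_power2[of "u + v"] by (simp add: power2_eq_square algebra_simps)
  have four: "(u - v) ^ 4 \<le> 8 * (u ^ 4 + v ^ 4)" for u v :: real
  proof -
    have "(u - v) ^ 4 = ((u - v)\<^sup>2)\<^sup>2" by simp
    also have "\<dots> \<le> (2 * (u\<^sup>2 + v\<^sup>2))\<^sup>2" by (intro power_mono sq) simp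
    also have "\<dots> = 4 * (u\<^sup>2 - - v\<^sup>2)\<^sup>2" by (simp add: power2_eq_square algebra_simps)
    also have "\<dots> \<le> 4 * (2 * ((u\<^sup>2)\<^sup>2 + (- v\<^sup>2)\<^sup>2))" by (intro mult_left_mono sq) simp
    finally show ?thesis by simp
  qed
  have xz: "(fst x - fst z) ^ 4 + 16 * (snd x - snd z)\<^sup>2 \<le> r ^ 4"
    and xw: "(fst x - fst w) ^ 4 + 16 * (snd x - snd w)\<^sup>2 \<le> r ^ 4"
    using assms r by (simp_all add: dist_Pi_le_iff)
  have "(fst z - fst w) ^ 4 \<le> 8 * ((fst x - fst w) ^ 4 + (fst x - fst z) ^ 4)"
    using four[of "fst x - fst w" "fst x - fst z"] by simp
  moreover have "(snd z - snd w)\<^sup>2 \<le> 2 * ((snd x - snd w)\<^sup>2 + (snd x - snd z)\<^sup>2)"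
    using sq[of "snd x - snd w" "snd x - snd z"] by simp
  \<comment> \<open>The powers are abstracted because only linear arithmetic is left.\<close>
  moreover have "p + 16 * q \<le> 16 * R"
    if "p \<le> 8 * (p\<^sub>1 + p\<^sub>2)" "q \<le> 2 * (q\<^sub>1 + q\<^sub>2)" "p\<^sub>1 + 16 * q\<^sub>1 \<le> R" "p\<^sub>2 + 16 * q\<^sub>2 \<le> R"
      "0 \<le> q\<^sub>1" "0 \<le> q\<^sub>2" for p q R p\<^sub>1 p\<^sub>2 q\<^sub>1 q\<^sub>2 :: real
    using that by argo
  ultimately have "(fst z - fst w) ^ 4 + 16 * (snd z - snd w)\<^sup>2 \<le> 16 * r ^ 4"
    using xz xw zero_le_power2 by blast
  then show ?thesis
    using r by (simp add: dist_Pi_le_iff power_mult_distrib)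
qed

text \<open>
  Continuity is with respect to the Euclidean topology, in which the anisotropic distance to a
  fixed point is a continuous function.
\<close>

lemma continuous_on_if_Holder:
  assumes "0 < \<alpha>" and "\<And>x y. \<bar>g y - g x\<bar> \<le> C * dist_Pi x y powr \<alpha>"
  shows "continuous_on UNIV g"
  unfolding continuous_on_def
proof (intro ballI)
  fix x
  have "((\<lambda>y. dist_Pi x y) \<longlongrightarrow> dist_Pi x x) (at x)"
    unfolding dist_Pi_def by (intro tendsto_intros)
  then have "((\<lambda>y. C * dist_Pi x y powr \<alpha>) \<longlongrightarrow> 0) (at x)"
    using assms(1) by (intro tendsto_mult_right_zero tendsto_zero_powrI[of _ _ _ \<alpha>])
      (auto simp: dist_Pi_nonneg)
  then have "((\<lambda>y. g y - g x) \<longlongrightarrow> 0) (at x)"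
    by (rule Lim_null_comparison[rotated]) (simp add: assms(2))
  then show "(g \<longlongrightarrow> g x) (at x within UNIV)"
    by (simp add: LIM_zero_iff)
qed

section \<open>Approximation by polynomials, without radii\<close>

definition quadratic :: "real \<Rightarrow> real \<Rightarrow> real \<Rightarrow> real \<Rightarrow> real \<times> real \<Rightarrow> real" where
  "quadratic a b c d v = a + b * fst v + c * (fst v)\<^sup>2 + d * snd v"

text \<open>
  Letting the radius decrease to \<open>d(x,y)\<close> turns the family of estimates over balls into one
  estimate at each \<open>y\<close>; at \<open>y = x\<close> the latter forces the constant term to be \<open>f(x)\<close>.
\<close>

lemma Gamma2_Pi_iff:
  assumes "0 < \<alpha>"
  shows "f \<in> Gamma2_Pi \<alpha> \<longleftrightarrow> (\<exists>C>0. \<exists>b c d. \<forall>x y.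
    \<bar>f y - quadratic (f x) (b x) (c x) (d x) (y - x)\<bar> \<le> C * dist_Pi x y powr (2 + \<alpha>))"
proof
  assume "f \<in> Gamma2_Pi \<alpha>"
  then obtain C where C: "C > 0" and ex: "\<forall>x. \<exists>a b c d. \<forall>\<rho>>0. \<forall>y \<in> ball_Pi x \<rho>.
      \<bar>f y - quadratic a b c d (y - x)\<bar> < C * \<rho> powr (2 + \<alpha>)"
    unfolding Gamma2_Pi_def quadratic_def Let_def by blast
  then obtain a b c d where abcd: "\<And>x \<rho> y. \<lbrakk>\<rho> > 0; y \<in> ball_Pi x \<rho>\<rbrakk> \<Longrightarrow>
      \<bar>f y - quadratic (a x) (b x) (c x) (d x) (y - x)\<bar> < C * \<rho> powr (2 + \<alpha>)"
    by metis
  have le: "\<bar>f y - quadratic (a x) (b x) (c x) (d x) (y - x)\<bar> \<le> C * dist_Pi x y powr (2 + \<alpha>)" for x y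
  proof (rule tendsto_lowerbound)
    show "((\<lambda>\<rho>. C * \<rho> powr (2 + \<alpha>)) \<longlongrightarrow> C * dist_Pi x y powr (2 + \<alpha>)) (at_right (dist_Pi x y))"
    proof (intro tendsto_mult tendsto_const tendsto_powr2 tendsto_ident_at)
      show "\<forall>\<^sub>F \<rho> in at_right (dist_Pi x y). 0 \<le> \<rho>"
        unfolding eventually_at_right_field
        using dist_Pi_nonneg[of x y] by (intro exI[of _ "dist_Pi x y + 1"]) auto
    qed (use assms in auto)
    show "\<forall>\<^sub>F \<rho> in at_right (dist_Pi x y).
        \<bar>f y - quadratic (a x) (b x) (c x) (d x) (y - x)\<bar> \<le> C * \<rho> powr (2 + \<alpha>)"
      unfolding eventually_at_right_field
    proof (intro exI[of _ "dist_Pi x y + 1"] conjI allI impI)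
      fix \<rho> assume "\<rho> > dist_Pi x y"
      then show "\<bar>f y - quadratic (a x) (b x) (c x) (d x) (y - x)\<bar> \<le> C * \<rho> powr (2 + \<alpha>)"
        using dist_Pi_nonneg[of x y] by (intro less_imp_le[OF abcd]) (auto simp: ball_Pi_def)
    qed simp
  qed simp
  have "a x = f x" for x
    using le[of x x] by (simp add: quadratic_def)
  then show "\<exists>C>0. \<exists>b c d. \<forall>x y.
    \<bar>f y - quadratic (f x) (b x) (c x) (d x) (y - x)\<bar> \<le> C * dist_Pi x y powr (2 + \<alpha>)"
    using C le by metis
next
  assume "\<exists>C>0. \<exists>b c d. \<forall>x y.
    \<bar>f y - quadratic (f x) (b x) (c x) (d x) (y - x)\<bar> \<le> C * dist_Pi x y powr (2 + \<alpha>)"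
  then obtain C b c d where C: "C > 0" and le: "\<And>x y.
    \<bar>f y - quadratic (f x) (b x) (c x) (d x) (y - x)\<bar> \<le> C * dist_Pi x y powr (2 + \<alpha>)"
    by blast
  have "\<bar>f y - quadratic (f x) (b x) (c x) (d x) (y - x)\<bar> < C * \<rho> powr (2 + \<alpha>)"
    if "y \<in> ball_Pi x \<rho>" for x y \<rho>
  proof -
    have "dist_Pi x y powr (2 + \<alpha>) < \<rho> powr (2 + \<alpha>)"
      using that assms by (intro powr_less_mono2) (auto simp: ball_Pi_def dist_Pi_nonneg)
    then show ?thesis
      using le[of y x] C by (smt (verit) mult_strict_left_mono)
  qed
  then show "f \<in> Gamma2_Pi \<alpha>"
    using C unfolding Gamma2_Pi_def quadratic_def Let_def by blast
qed

section \<open>Differentiable functions are approximated by their Taylor polynomials\<close>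

lemma Taylor_order_1:
  fixes g g' :: "real \<Rightarrow> real"
  assumes "\<And>t. (g has_real_derivative g' t) (at t)"
  obtains \<xi> where "\<bar>\<xi> - a\<bar> \<le> \<bar>x - a\<bar>" "g x = g a + g' \<xi> * (x - a)"
proof (cases "x = a")
  case False
  have "\<exists>\<xi>. (if x < a then x < \<xi> \<and> \<xi> < a else a < \<xi> \<and> \<xi> < x) \<and>
      g x = (\<Sum>m<1. (if m = 0 then g else g') a / fact m * (x - a) ^ m)
        + (if (1::nat) = 0 then g else g') \<xi> / fact 1 * (x - a) ^ 1"
    using assms False
    by (intro Taylor[where a = "min a x" and b = "max a x"]) auto
  then obtain \<xi> where "if x < a then x < \<xi> \<and> \<xi> < a else a < \<xi> \<and> \<xi> < x"
    and "g x = g a + g' \<xi> * (x - a)"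
    by auto
  then show ?thesis
    by (intro that[of \<xi>]) (auto split: if_splits)
qed (use that[of a] in auto)

lemma Taylor_order_2:
  fixes g g' g'' :: "real \<Rightarrow> real"
  assumes "\<And>t. (g has_real_derivative g' t) (at t)" "\<And>t. (g' has_real_derivative g'' t) (at t)"
  obtains \<xi> where "\<bar>\<xi> - a\<bar> \<le> \<bar>x - a\<bar>" "g x = g a + g' a * (x - a) + g'' \<xi> / 2 * (x - a)\<^sup>2"
proof (cases "x = a")
  case False
  define D where "D = (\<lambda>m::nat. if m = 0 then g else if m = 1 then g' else g'')"
  have "\<exists>\<xi>. (if x < a then x < \<xi> \<and> \<xi> < a else a < \<xi> \<and> \<xi> < x) \<and>
      g x = (\<Sum>m<2. D m a / fact m * (x - a) ^ m) + D 2 \<xi> / fact 2 * (x - a) ^ 2"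
  proof (intro Taylor[where a = "min a x" and b = "max a x"] allI impI)
    show "(D m has_real_derivative D (Suc m) t) (at t)"
      if "m < 2 \<and> min a x \<le> t \<and> t \<le> max a x" for m t
      using that assms by (cases "m = 0") (auto simp: D_def less_2_cases_iff)
  qed (use False in \<open>auto simp: D_def\<close>)
  then obtain \<xi> where "if x < a then x < \<xi> \<and> \<xi> < a else a < \<xi> \<and> \<xi> < x"
    and "g x = (\<Sum>m<2. D m a / fact m * (x - a) ^ m) + D 2 \<xi> / fact 2 * (x - a) ^ 2"
    by blast
  then show ?thesis
    by (intro that[of \<xi>]) (auto simp: D_def numeral_2_eq_2 split: if_splits)
qed (use that[of a] in auto)

lemma Taylor_remainder_bound:
  assumes f2: "has_partial2 f f2" and f22: "has_partial2 f2 f22" and f3: "has_partial3 f f3"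
    and C: "C > 0"
    and holder22: "\<And>x y. \<bar>f22 y - f22 x\<bar> \<le> C * dist_Pi x y powr \<alpha>"
    and holder3: "\<And>x y. \<bar>f3 y - f3 x\<bar> \<le> C * dist_Pi x y powr \<alpha>"
    and \<alpha>: "0 < \<alpha>"
  shows "\<bar>f y - quadratic (f x) (f2 x) (f22 x / 2) (f3 x) (y - x)\<bar> \<le> C * dist_Pi x y powr (2 + \<alpha>)"
proof -
  obtain s t where x: "x = (s, t)" by fastforce
  obtain s' t' where y: "y = (s', t')" by fastforce
  define r where "r = dist_Pi x y"
  have r: "0 \<le> r" by (simp add: r_def dist_Pi_nonneg)
  have ds: "((\<lambda>u. f (u, t)) has_real_derivative f2 (u, t)) (at u)"
    and dss: "((\<lambda>u. f2 (u, t)) has_real_derivative f22 (u, t)) (at u)"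
    and dt: "((\<lambda>u. f (s', u)) has_real_derivative f3 (s', u)) (at u)" for u
    using f2 f22 f3 unfolding has_partial2_def has_partial3_def by (metis fst_conv snd_conv)+
  obtain \<xi> where \<xi>: "\<bar>\<xi> - s\<bar> \<le> \<bar>s' - s\<bar>"
      "f (s', t) = f (s, t) + f2 (s, t) * (s' - s) + f22 (\<xi>, t) / 2 * (s' - s)\<^sup>2"
    using Taylor_order_2[OF ds dss] by blast
  obtain \<eta> where \<eta>: "\<bar>\<eta> - t\<bar> \<le> \<bar>t' - t\<bar>"
      "f (s', t') = f (s', t) + f3 (s', \<eta>) * (t' - t)"
    using Taylor_order_1[OF dt] by blast
  have holder: "C * dist_Pi x p powr \<alpha> \<le> C * r powr \<alpha>"
    if "\<bar>fst p - s\<bar> \<le> \<bar>s' - s\<bar>" "\<bar>snd p - t\<bar> \<le> \<bar>t' - t\<bar>" for p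
  proof -
    have "dist_Pi x p \<le> r"
      unfolding r_def using that by (intro dist_Pi_mono) (simp_all add: x y)
    then show ?thesis
      using C \<alpha> by (intro mult_left_mono powr_mono2) (auto simp: dist_Pi_nonneg)
  qed
  have e2: "\<bar>f22 (\<xi>, t) - f22 x\<bar> \<le> C * r powr \<alpha>"
    using holder22[of "(\<xi>, t)" x] holder[of "(\<xi>, t)"] \<xi>(1) by simp
  have e3: "\<bar>f3 (s', \<eta>) - f3 x\<bar> \<le> C * r powr \<alpha>"
    using holder3[of "(s', \<eta>)" x] holder[of "(s', \<eta>)"] \<eta>(1) by simp
  have v2: "(s' - s)\<^sup>2 \<le> r\<^sup>2"
    using abs_fst_diff_le_dist_Pi[of y x] r by (simp add: r_def x y flip: abs_le_square_iff)
  have v3: "\<bar>t' - t\<bar> \<le> r\<^sup>2 / 4"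
    using abs_snd_diff_le_dist_Pi[of y x] by (simp add: r_def x y)
  have "f y - quadratic (f x) (f2 x) (f22 x / 2) (f3 x) (y - x)
      = (f22 (\<xi>, t) - f22 x) / 2 * (s' - s)\<^sup>2 + (f3 (s', \<eta>) - f3 x) * (t' - t)"
    by (simp add: quadratic_def x y \<xi>(2) \<eta>(2) field_simps)
  also have "\<bar>\<dots>\<bar> \<le> \<bar>f22 (\<xi>, t) - f22 x\<bar> / 2 * (s' - s)\<^sup>2 + \<bar>f3 (s', \<eta>) - f3 x\<bar> * \<bar>t' - t\<bar>"
    by (rule order_trans[OF abs_triangle_ineq]) (simp add: abs_mult)
  also have "\<dots> \<le> C * r powr \<alpha> / 2 * r\<^sup>2 + C * r powr \<alpha> * (r\<^sup>2 / 4)"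
    using e2 e3 v2 v3 C by (intro add_mono mult_mono) auto
  also have "\<dots> \<le> C * (r powr \<alpha> * r\<^sup>2)"
    using C by (simp add: field_simps)
  also have "r powr \<alpha> * r\<^sup>2 = r powr (2 + \<alpha>)"
    using r \<alpha> by (cases "r = 0") (auto simp: powr_add)
  finally show ?thesis by (simp add: r_def)
qed

section \<open>Approximable functions are differentiable\<close>

text \<open>An error of order higher than one leaves the linear term as the derivative.\<close>

lemma has_derivative_if_superlinear_error:
  fixes g :: "real \<Rightarrow> real"
  assumes "1 < p" and "\<And>t. \<bar>g t - g a - D * (t - a)\<bar> \<le> K * \<bar>t - a\<bar> powr p"
  shows "(g has_real_derivative D) (at a)"
proof -
  have "((\<lambda>t. \<bar>t - a\<bar>) \<longlongrightarrow> \<bar>a - a\<bar>) (at a)" by (intro tendsto_intros)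
  then have "((\<lambda>t. K * \<bar>t - a\<bar> powr (p - 1)) \<longlongrightarrow> 0) (at a)"
    using assms(1) by (intro tendsto_mult_right_zero tendsto_zero_powrI[of _ _ _ "p - 1"]) auto
  moreover have "\<forall>\<^sub>F t in at a. norm ((g t - g a) / (t - a) - D) \<le> K * \<bar>t - a\<bar> powr (p - 1)"
    unfolding eventually_at_filter
  proof (intro always_eventually allI impI)
    fix t assume "t \<noteq> a"
    then have "norm ((g t - g a) / (t - a) - D) = \<bar>g t - g a - D * (t - a)\<bar> / \<bar>t - a\<bar>"
      by (simp add: field_simps flip: abs_divide)
    also have "\<dots> \<le> K * \<bar>t - a\<bar> powr p / \<bar>t - a\<bar>"
      by (intro divide_right_mono assms(2)) simp
    also have "\<dots> = K * \<bar>t - a\<bar> powr (p - 1)"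
      using \<open>t \<noteq> a\<close> by (simp add: powr_diff)
    finally show "norm ((g t - g a) / (t - a) - D) \<le> K * \<bar>t - a\<bar> powr (p - 1)" .
  qed
  ultimately have "((\<lambda>t. (g t - g a) / (t - a) - D) \<longlongrightarrow> 0) (at a)"
    by (rule Lim_null_comparison[rotated])
  then show ?thesis
    by (simp add: has_field_derivative_iff LIM_zero_iff)
qed

text \<open>
  The values at the centre and at the three points \<open>(r, 0)\<close>, \<open>(-r, 0)\<close>, \<open>(0, r\<^sup>2/4)\<close> of the unit
  sphere dilated by \<open>r\<close> already determine the four coefficients.
\<close>

lemma quadratic_coefficient_bounds:
  assumes "0 < r"
    and "\<And>v. dist_Pi 0 v \<le> r \<Longrightarrow> \<bar>quadratic A B G D v\<bar> \<le> M"
  shows "\<bar>B\<bar> \<le> M / r" "\<bar>G\<bar> \<le> 2 * M / r\<^sup>2" "\<bar>D\<bar> \<le> 8 * M / r\<^sup>2"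
proof -
  have fst: "dist_Pi 0 (s, 0) = \<bar>s\<bar>" for s
    using dist_Pi_along_fst[of 0 0 s] by (simp add: zero_prod_def)
  have "sqrt (r\<^sup>2 / 4) = r / 2" using assms(1) by (simp add: real_sqrt_divide)
  then have snd: "dist_Pi 0 (0, r\<^sup>2 / 4) = r"
    using dist_Pi_along_snd[of 0 0 "r\<^sup>2 / 4"] by (simp add: zero_prod_def)
  have 0: "\<bar>A\<bar> \<le> M"
    and p: "\<bar>A + B * r + G * r\<^sup>2\<bar> \<le> M"
    and m: "\<bar>A - B * r + G * r\<^sup>2\<bar> \<le> M"
    and t: "\<bar>A + D * (r\<^sup>2 / 4)\<bar> \<le> M"
    using assms(2)[of "(0, 0)"] assms(2)[of "(r, 0)"] assms(2)[of "(- r, 0)"]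
      assms(2)[of "(0, r\<^sup>2 / 4)"] assms(1)
    by (auto simp: quadratic_def fst snd)
  have "\<bar>B * r\<bar> \<le> M" "\<bar>G * r\<^sup>2\<bar> \<le> 2 * M" "\<bar>D * r\<^sup>2\<bar> \<le> 8 * M"
    using 0 p m t by linarith+
  then show "\<bar>B\<bar> \<le> M / r" "\<bar>G\<bar> \<le> 2 * M / r\<^sup>2" "\<bar>D\<bar> \<le> 8 * M / r\<^sup>2"
    using assms(1) by (auto simp: abs_mult pos_le_divide_eq)
qed

locale approximable =
  fixes f b c d :: "real \<times> real \<Rightarrow> real" and C \<alpha> :: real
  assumes \<alpha>: "0 < \<alpha>" "\<alpha> < 1" and C: "0 < C"
    and approx: "\<bar>f y - quadratic (f x) (b x) (c x) (d x) (y - x)\<bar> \<le> C * dist_Pi x y powr (2 + \<alpha>)"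
begin

text \<open>
  Campanato's comparison. Recentring the polynomial at \<open>z\<close> to \<open>x\<close> leaves its top coefficients
  alone and turns the first order one into \<open>b z + 2 c z (x\<^sub>2 - z\<^sub>2)\<close>. The constant \<open>9\<close> is
  \<open>1 + 2\<^sup>3\<close>: points of the ball about \<open>x\<close> have distance at most \<open>2 r\<close> from \<open>z\<close>, and
  \<open>(2 r)\<^sup>2\<^sup>+\<^sup>\<alpha> \<le> 8 r\<^sup>2\<^sup>+\<^sup>\<alpha>\<close>.
\<close>

lemma coefficients_vary:
  shows "\<bar>b x - b z - 2 * c z * (fst x - fst z)\<bar> \<le> 9 * C * dist_Pi x z powr (1 + \<alpha>)" (is ?B)
    and "\<bar>c x - c z\<bar> \<le> 18 * C * dist_Pi x z powr \<alpha>" (is ?G)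
    and "\<bar>d x - d z\<bar> \<le> 72 * C * dist_Pi x z powr \<alpha>" (is ?D)
proof -
  have "?B \<and> ?G \<and> ?D"
  proof (cases "x = z")
    case True
    then show ?thesis by simp
  next
    case False
    define r where "r = dist_Pi x z"
    have r: "0 < r"
      using False dist_Pi_nonneg[of x z] dist_Pi_eq_0_iff[of x z] unfolding r_def by linarith
    define h where "h = fst x - fst z"
    define A where "A = f x - (f z + b z * h + c z * h\<^sup>2 + d z * (snd x - snd z))"
    define B where "B = b x - b z - 2 * c z * h"
    define G where "G = c x - c z"
    define D where "D = d x - d z"
    define M where "M = 9 * C * r powr (2 + \<alpha>)"
    have bound: "\<bar>quadratic A B G D v\<bar> \<le> M" if "dist_Pi 0 v \<le> r" for v
    proof -
      define w where "w = x + v"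
      have xw: "dist_Pi x w \<le> r"
        using that by (simp add: w_def dist_Pi_def)
      have zw: "dist_Pi z w \<le> 2 * r"
        using dist_Pi_quasi_triangle[of x z r w] xw by (simp add: r_def)
      have "dist_Pi x w powr (2 + \<alpha>) \<le> r powr (2 + \<alpha>)"
        using xw \<alpha> by (intro powr_mono2) (auto simp: dist_Pi_nonneg)
      then have ex: "\<bar>f w - quadratic (f x) (b x) (c x) (d x) (w - x)\<bar> \<le> C * r powr (2 + \<alpha>)"
        using approx[of w x] C by (smt (verit) mult_left_mono)
      have "dist_Pi z w powr (2 + \<alpha>) \<le> (2 * r) powr (2 + \<alpha>)"
        using zw \<alpha> by (intro powr_mono2) (auto simp: dist_Pi_nonneg)
      also have "\<dots> = 2 powr (2 + \<alpha>) * r powr (2 + \<alpha>)"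
        using r by (simp add: powr_mult)
      also have "\<dots> \<le> 2 powr 3 * r powr (2 + \<alpha>)"
        using \<alpha> by (intro mult_right_mono powr_mono) auto
      finally have "dist_Pi z w powr (2 + \<alpha>) \<le> 8 * r powr (2 + \<alpha>)" by simp
      then have "C * dist_Pi z w powr (2 + \<alpha>) \<le> C * (8 * r powr (2 + \<alpha>))"
        using C by (intro mult_left_mono) auto
      then have ez: "\<bar>f w - quadratic (f z) (b z) (c z) (d z) (w - z)\<bar> \<le> 8 * (C * r powr (2 + \<alpha>))"
        using approx[of w z] by simp
      have "quadratic A B G D v
          = quadratic (f x) (b x) (c x) (d x) (w - x) - quadratic (f z) (b z) (c z) (d z) (w - z)"
        by (simp add: quadratic_def A_def B_def G_def D_def h_def w_def power2_eq_square algebra_simps)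
      then show ?thesis
        using ex ez unfolding M_def by linarith
    qed
    have "M / r = 9 * C * r powr (1 + \<alpha>)" "M / r\<^sup>2 = 9 * C * r powr \<alpha>"
      using r by (simp_all add: M_def powr_add power2_eq_square)
    then show ?thesis
      using quadratic_coefficient_bounds[OF r bound]
      by (auto simp: B_def G_def D_def h_def r_def)
  qed
  then show ?B ?G ?D by auto
qed

lemma partial2: "has_partial2 f b"
  unfolding has_partial2_def
proof (intro allI)
  fix x :: "real \<times> real"
  obtain s t where x: "x = (s, t)" by fastforce
  \<comment> \<open>The quadratic term is smooth but not of order \<open>2 + \<alpha>\<close>, hence split off first.\<close>
  have "((\<lambda>u. f (u, t) - c x * (u - s)\<^sup>2) has_real_derivative b x) (at s)"
  proof (rule has_derivative_if_superlinear_error[of "2 + \<alpha>"])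
    show "\<bar>f (u, t) - c x * (u - s)\<^sup>2 - (f (s, t) - c x * (s - s)\<^sup>2) - b x * (u - s)\<bar>
        \<le> C * \<bar>u - s\<bar> powr (2 + \<alpha>)" for u
      using approx[of "(u, t)" x] by (simp add: x quadratic_def dist_Pi_along_fst algebra_simps)
  qed (use \<alpha> in simp)
  then have "((\<lambda>u. f (u, t) - c x * (u - s)\<^sup>2 + c x * (u - s)\<^sup>2) has_real_derivative b x + 0) (at s)"
    by (rule DERIV_add) (auto intro!: derivative_eq_intros)
  then show "((\<lambda>u. f (u, snd x)) has_real_derivative b x) (at (fst x))"
    by (simp add: x)
qed

lemma partial22: "has_partial2 b (\<lambda>x. 2 * c x)"
  unfolding has_partial2_def
proof (intro allI)
  fix x :: "real \<times> real"
  obtain s t where x: "x = (s, t)" by fastforce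
  have "((\<lambda>u. b (u, t)) has_real_derivative 2 * c x) (at s)"
  proof (rule has_derivative_if_superlinear_error[of "1 + \<alpha>"])
    show "\<bar>b (u, t) - b (s, t) - 2 * c x * (u - s)\<bar> \<le> 9 * C * \<bar>u - s\<bar> powr (1 + \<alpha>)" for u
      using coefficients_vary(1)[of "(u, t)" x]
      by (simp add: x dist_Pi_along_fst abs_minus_commute)
  qed (use \<alpha> in simp)
  then show "((\<lambda>u. b (u, snd x)) has_real_derivative 2 * c x) (at (fst x))"
    by (simp add: x)
qed

lemma partial3: "has_partial3 f d"
  unfolding has_partial3_def
proof (intro allI)
  fix x :: "real \<times> real"
  obtain s t where x: "x = (s, t)" by fastforce
  have "((\<lambda>u. f (s, u)) has_real_derivative d x) (at t)"
    \<comment> \<open>Along \<open>x\<^sub>3\<close> the distance is a square root, which halves the order of the error.\<close>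
  proof (rule has_derivative_if_superlinear_error[of "(2 + \<alpha>) / 2"])
    fix u
    have "(2 * sqrt \<bar>u - t\<bar>) powr (2 + \<alpha>) = 2 powr (2 + \<alpha>) * \<bar>u - t\<bar> powr ((2 + \<alpha>) / 2)"
      by (simp add: powr_mult powr_powr flip: powr_half_sqrt)
    then show "\<bar>f (s, u) - f (s, t) - d x * (u - t)\<bar>
        \<le> C * 2 powr (2 + \<alpha>) * \<bar>u - t\<bar> powr ((2 + \<alpha>) / 2)"
      using approx[of "(s, u)" x] by (simp add: x quadratic_def dist_Pi_along_snd algebra_simps)
  qed (use \<alpha> in simp)
  then show "((\<lambda>u. f (fst x, u)) has_real_derivative d x) (at (snd x))"
    by (simp add: x)
qed

lemma in_C2_Pi: "f \<in> C2_Pi \<alpha>"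
proof -
  have holder: "\<bar>2 * c y - 2 * c x\<bar> \<le> 72 * C * dist_Pi x y powr \<alpha>"
    "\<bar>d y - d x\<bar> \<le> 72 * C * dist_Pi x y powr \<alpha>" for x y
  proof -
    have "0 \<le> C * dist_Pi x y powr \<alpha>" using C by simp
    then show "\<bar>2 * c y - 2 * c x\<bar> \<le> 72 * C * dist_Pi x y powr \<alpha>"
      "\<bar>d y - d x\<bar> \<le> 72 * C * dist_Pi x y powr \<alpha>"
      using coefficients_vary(2,3)[where x = x and z = y] by linarith+
  qed
  have "continuous_on UNIV (\<lambda>x. 2 * c x)" "continuous_on UNIV d"
    using holder by (auto intro!: continuous_on_if_Holder[OF \<alpha>(1)])
  moreover have "0 < 72 * C" using C by simp
  ultimately show ?thesis
    unfolding C2_Pi_def using partial2 partial22 partial3 holder by blast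
qed

end

theorem proposition4p4:
  fixes \<alpha> :: real and f :: "real \<times> real \<Rightarrow> real"
  assumes "0 < \<alpha>" and "\<alpha> < 1"
    and "bounded (range f)"
  shows "f \<in> C2_Pi \<alpha> \<longleftrightarrow> f \<in> Gamma2_Pi \<alpha>"
proof
  assume "f \<in> C2_Pi \<alpha>"
  then obtain f2 f22 f3 C where "has_partial2 f f2" "has_partial2 f2 f22" "has_partial3 f f3" "C > 0"
    and "\<And>x y. \<bar>f22 y - f22 x\<bar> \<le> C * dist_Pi x y powr \<alpha>"
    and "\<And>x y. \<bar>f3 y - f3 x\<bar> \<le> C * dist_Pi x y powr \<alpha>"
    unfolding C2_Pi_def by blast
  then have "\<bar>f y - quadratic (f x) (f2 x) (f22 x / 2) (f3 x) (y - x)\<bar> \<le> C * dist_Pi x y powr (2 + \<alpha>)"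
    for x y
    using Taylor_remainder_bound assms(1) by blast
  with \<open>C > 0\<close> show "f \<in> Gamma2_Pi \<alpha>"
    unfolding Gamma2_Pi_iff[OF assms(1)]
    by (intro exI[of _ C] conjI exI[of _ f2] exI[of _ "\<lambda>x. f22 x / 2"] exI[of _ f3]) auto
next
  assume "f \<in> Gamma2_Pi \<alpha>"
  then obtain C b c d where "C > 0" and "\<And>x y.
    \<bar>f y - quadratic (f x) (b x) (c x) (d x) (y - x)\<bar> \<le> C * dist_Pi x y powr (2 + \<alpha>)"
    unfolding Gamma2_Pi_iff[OF assms(1)] by blast
  then interpret approximable f b c d C \<alpha>
    using assms(1,2) by unfold_locales auto
  show "f \<in> C2_Pi \<alpha>" by (rule in_C2_Pi)
qed

end
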